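(* Let $N,n\ge 1$, let $c,\eta\in\mathbb C$ with $c\neq 0$, and consider canonical coordinates $p^a_i,q^a_i$ ($i=1,\dots,N$, $a=1,\dots,n$) with $\{p^a_i,q^b_j\}=\delta^{ab}\delta_{ij}$, $\{p^a_i,p^b_j\}=\{q^a_i,q^b_j\}=0$; the upper (site) indices are taken modulo $n$, so $q^0_i=q^n_i$, $p^0_i=p^n_i$, $q^{n+1}_i=q^1_i$, $p^{n+1}_i=p^1_i$. For $a=1,\dots,n$ define $N\times N$ matrices $$L^a_{ij}(z)=\phi(z,q^{a-1}_i-q^a_j+\eta)\,\frac{\prod_{l=1}^N\vartheta(q^a_j-q^{a-1}_l-\eta)}{\vartheta(-\eta)\prod_{l\neq j}\vartheta(q^a_j-q^a_l)}\,e^{p^a_j/c}.$$ Define $$r^a_{12}(z,w)=\sum_{i\neq j}\phi(z-w,q^a_i-q^a_j)E_{ij}\otimes E_{ji}+E_1(z-w)\sum_i E_{ii}\otimes E_{ii}-\sum_{i\neq j}E_1(q^a_i-q^a_j)E_{ii}\otimes E_{jj},$$ $$u^{+,a}_{12}=\sum_{i,j}E_1(q^{a-1}_j-q^a_i+\eta)E_{ii}\otimes E_{jj},\qquad u^{-,a}_{12}=-\sum_{i,j}E_1(q^{a-1}_i-q^a_j+\eta)E_{ii}\otimes E_{jj},$$ and with $D^a_{ij}(z)=L^a_{ij}(z)\big(E_1(z+q^{a-1}_i-q^a_j+\eta)-E_1(q^{a-1}_i-q^a_j+\eta)\big)$, $$s^a_{12}(z)=\sum_{i,j,m}(L^a(z)^{-1})_{mi}D^a_{ij}(z)E_{mj}\otimes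 E_{ii},\qquad s^a_{21}(w)=\sum_{i,j,m}(L^a(w)^{-1})_{mi}D^a_{ij}(w)E_{ii}\otimes E_{mj},$$ $s^{+,a}_{12}(z)=s^a_{12}(z)+u^{+,a}_{12}$, $s^{-,a}_{12}(w)=s^a_{21}(w)-u^{-,a}_{12}$. Then for all $a,b\in\{1,\dots,n\}$, identically in $z,w$, $$c\{L^a_1(z),L^b_2(w)\}=\delta^{ab}\Big(L^b_1(z)L^b_2(w)r^b_{12}(z,w)-r^{b-1}_{12}(z,w)L^b_1(z)L^b_2(w)+L^b_1(z)s^{+,b}_{12}(z)L^b_2(w)-L^b_2(w)s^{-,b}_{12}(w)L^b_1(z)\Big)$$ $$+\delta^{a,b-1}L^{b-1}_1(z)L^b_2(w)s^{-,b}_{12}(w)-\delta^{a,b+1}L^{b+1}_1(z)L^b_2(w)s^{+,b+1}_{12}(z),$$ where the Kronecker symbols $\delta^{a,b\pm1}$ and the indices $b\pm1$ are understood modulo $n$.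
   Context: $\vartheta(z)=-\sum_{j\in\mathbb Z}\exp\big(\pi\imath(j+\tfrac12)^2\tau+2\pi\imath(j+\tfrac12)(z+\tfrac12)\big)$ is the odd Jacobi theta function with $\mathrm{Im}\,\tau>0$; $\phi(z,u)=\frac{\vartheta'(0)\vartheta(z+u)}{\vartheta(z)\vartheta(u)}$; $E_1(u)=\vartheta'(u)/\vartheta(u)$. $E_{ij}$ are $N\times N$ matrix units; $L_1=L\otimes 1_N$, $L_2=1_N\otimes L$, $\{A_1(z),B_2(w)\}=\sum_{i,j,k,l}E_{ij}\otimes E_{kl}\{A_{ij}(z),B_{kl}(w)\}$. The Poisson bracket is $\{f,g\}=\sum_{a,i}(\partial_{p^a_i}f\,\partial_{q^a_i}g-\partial_{q^a_i}f\,\partial_{p^a_i}g)$. All quantities are taken at generic values so that they are defined (in particular $L^a(z)$ invertible). *)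

theory Defs
  imports "HOL-Analysis.Analysis"
begin

definition jtheta :: "complex \<Rightarrow> complex \<Rightarrow> complex" where
  "jtheta tau z = - infsum (\<lambda>j::int. exp (of_real pi * \<i> * (of_int j + 1/2)^2 * tau
        + 2 * of_real pi * \<i> * (of_int j + 1/2) * (z + 1/2))) UNIV"

definition ellphi :: "complex \<Rightarrow> complex \<Rightarrow> complex \<Rightarrow> complex" where
  "ellphi tau z u = deriv (jtheta tau) 0 * jtheta tau (z + u) / (jtheta tau z * jtheta tau u)"

definition E1 :: "complex \<Rightarrow> complex \<Rightarrow> complex" where
  "E1 tau u = deriv (jtheta tau) u / jtheta tau u"

definition cprev :: "nat \<Rightarrow> nat \<Rightarrow> nat" where
  "cprev n a = (if a = 1 then n else a - 1)"

definition cnext :: "nat \<Rightarrow> nat \<Rightarrow> nat" where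
  "cnext n a = (if a = n then 1 else a + 1)"

text \<open>Phase-space coordinates: p a i, q a i for sites a in 1..n and particle indices
  i in the finite type 'N (of cardinality N).\<close>

type_synonym 'N coords = "nat \<Rightarrow> 'N \<Rightarrow> complex"

definition dq :: "nat \<Rightarrow> 'N \<Rightarrow> ('N coords \<Rightarrow> 'N coords \<Rightarrow> complex) \<Rightarrow> 'N coords \<Rightarrow> 'N coords \<Rightarrow> complex" where
  "dq a i f p q = deriv (\<lambda>x. f p (q(a := (q a)(i := x)))) (q a i)"

definition dp :: "nat \<Rightarrow> 'N \<Rightarrow> ('N coords \<Rightarrow> 'N coords \<Rightarrow> complex) \<Rightarrow> 'N coords \<Rightarrow> 'N coords \<Rightarrow> complex" where
  "dp a i f p q = deriv (\<lambda>x. f (p(a := (p a)(i := x))) q) (p a i)"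

definition pb :: "nat \<Rightarrow> ('N::finite coords \<Rightarrow> 'N coords \<Rightarrow> complex) \<Rightarrow> ('N coords \<Rightarrow> 'N coords \<Rightarrow> complex)
     \<Rightarrow> 'N coords \<Rightarrow> 'N coords \<Rightarrow> complex" where
  "pb n f g p q = (\<Sum>a\<in>{1..n}. \<Sum>i\<in>UNIV. dp a i f p q * dq a i g p q - dq a i f p q * dp a i g p q)"

definition munit :: "'N::finite \<Rightarrow> 'N \<Rightarrow> complex^'N^'N" where
  "munit i j = (\<chi> r s. if r = i \<and> s = j then 1 else 0)"

definition tens :: "complex^'N^'N \<Rightarrow> complex^'N^'N \<Rightarrow> complex^('N \<times> 'N)^('N \<times> 'N)" where
  "tens A B = (\<chi> x y. A $ fst x $ fst y * B $ snd x $ snd y)"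

definition smat :: "complex \<Rightarrow> complex^'m^'n \<Rightarrow> complex^'m^'n" where
  "smat c M = (\<chi> x y. c * M $ x $ y)"

definition pbm :: "nat \<Rightarrow> ('N::finite coords \<Rightarrow> 'N coords \<Rightarrow> complex^'N^'N)
    \<Rightarrow> ('N coords \<Rightarrow> 'N coords \<Rightarrow> complex^'N^'N) \<Rightarrow> 'N coords \<Rightarrow> 'N coords
    \<Rightarrow> complex^('N \<times> 'N)^('N \<times> 'N)" where
  "pbm n A B p q = (\<chi> x y. pb n (\<lambda>p q. A p q $ fst x $ fst y) (\<lambda>p q. B p q $ snd x $ snd y) p q)"

definition Lmat :: "complex \<Rightarrow> complex \<Rightarrow> complex \<Rightarrow> nat \<Rightarrow> nat \<Rightarrow> complex
     \<Rightarrow> 'N::finite coords \<Rightarrow> 'N coords \<Rightarrow> complex^'N^'N" where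
  "Lmat tau eta c n a z p q = (\<chi> i j.
      ellphi tau z (q (cprev n a) i - q a j + eta)
      * (\<Prod>l\<in>UNIV. jtheta tau (q a j - q (cprev n a) l - eta))
      / (jtheta tau (- eta) * (\<Prod>l\<in>UNIV - {j}. jtheta tau (q a j - q a l)))
      * exp (p a j / c))"

definition L1 :: "complex \<Rightarrow> complex \<Rightarrow> complex \<Rightarrow> nat \<Rightarrow> nat \<Rightarrow> complex
     \<Rightarrow> 'N::finite coords \<Rightarrow> 'N coords \<Rightarrow> complex^('N \<times> 'N)^('N \<times> 'N)" where
  "L1 tau eta c n a z p q = tens (Lmat tau eta c n a z p q) (mat 1)"

definition L2 :: "complex \<Rightarrow> complex \<Rightarrow> complex \<Rightarrow> nat \<Rightarrow> nat \<Rightarrow> complex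
     \<Rightarrow> 'N::finite coords \<Rightarrow> 'N coords \<Rightarrow> complex^('N \<times> 'N)^('N \<times> 'N)" where
  "L2 tau eta c n a z p q = tens (mat 1) (Lmat tau eta c n a z p q)"

definition rmat :: "complex \<Rightarrow> nat \<Rightarrow> 'N::finite coords \<Rightarrow> complex \<Rightarrow> complex
     \<Rightarrow> complex^('N \<times> 'N)^('N \<times> 'N)" where
  "rmat tau a q z w =
     (\<Sum>i\<in>UNIV. \<Sum>j\<in>UNIV - {i}. smat (ellphi tau (z - w) (q a i - q a j)) (tens (munit i j) (munit j i)))
     + smat (E1 tau (z - w)) (\<Sum>i\<in>UNIV. tens (munit i i) (munit i i))
     - (\<Sum>i\<in>UNIV. \<Sum>j\<in>UNIV - {i}. smat (E1 tau (q a i - q a j)) (tens (munit i i) (munit j j)))"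

definition uplus :: "complex \<Rightarrow> complex \<Rightarrow> nat \<Rightarrow> nat \<Rightarrow> 'N::finite coords
     \<Rightarrow> complex^('N \<times> 'N)^('N \<times> 'N)" where
  "uplus tau eta n a q =
     (\<Sum>i\<in>UNIV. \<Sum>j\<in>UNIV. smat (E1 tau (q (cprev n a) j - q a i + eta)) (tens (munit i i) (munit j j)))"

definition uminus_mat :: "complex \<Rightarrow> complex \<Rightarrow> nat \<Rightarrow> nat \<Rightarrow> 'N::finite coords
     \<Rightarrow> complex^('N \<times> 'N)^('N \<times> 'N)" where
  "uminus_mat tau eta n a q =
     - (\<Sum>i\<in>UNIV. \<Sum>j\<in>UNIV. smat (E1 tau (q (cprev n a) i - q a j + eta)) (tens (munit i i) (munit j j)))"

definition Dmat :: "complex \<Rightarrow> complex \<Rightarrow> complex \<Rightarrow> nat \<Rightarrow> nat \<Rightarrow> complex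
     \<Rightarrow> 'N::finite coords \<Rightarrow> 'N coords \<Rightarrow> complex^'N^'N" where
  "Dmat tau eta c n a z p q = (\<chi> i j. Lmat tau eta c n a z p q $ i $ j
      * (E1 tau (z + q (cprev n a) i - q a j + eta) - E1 tau (q (cprev n a) i - q a j + eta)))"

definition s12 :: "complex \<Rightarrow> complex \<Rightarrow> complex \<Rightarrow> nat \<Rightarrow> nat \<Rightarrow> complex
     \<Rightarrow> 'N::finite coords \<Rightarrow> 'N coords \<Rightarrow> complex^('N \<times> 'N)^('N \<times> 'N)" where
  "s12 tau eta c n a z p q =
     (\<Sum>i\<in>UNIV. \<Sum>j\<in>UNIV. \<Sum>m\<in>UNIV.
        smat (matrix_inv (Lmat tau eta c n a z p q) $ m $ i * Dmat tau eta c n a z p q $ i $ j)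
             (tens (munit m j) (munit i i)))"

definition s21 :: "complex \<Rightarrow> complex \<Rightarrow> complex \<Rightarrow> nat \<Rightarrow> nat \<Rightarrow> complex
     \<Rightarrow> 'N::finite coords \<Rightarrow> 'N coords \<Rightarrow> complex^('N \<times> 'N)^('N \<times> 'N)" where
  "s21 tau eta c n a w p q =
     (\<Sum>i\<in>UNIV. \<Sum>j\<in>UNIV. \<Sum>m\<in>UNIV.
        smat (matrix_inv (Lmat tau eta c n a w p q) $ m $ i * Dmat tau eta c n a w p q $ i $ j)
             (tens (munit i i) (munit m j)))"

definition splus :: "complex \<Rightarrow> complex \<Rightarrow> complex \<Rightarrow> nat \<Rightarrow> nat \<Rightarrow> complex
     \<Rightarrow> 'N::finite coords \<Rightarrow> 'N coords \<Rightarrow> complex^('N \<times> 'N)^('N \<times> 'N)" where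
  "splus tau eta c n a z p q = s12 tau eta c n a z p q + uplus tau eta n a q"

definition sminus :: "complex \<Rightarrow> complex \<Rightarrow> complex \<Rightarrow> nat \<Rightarrow> nat \<Rightarrow> complex
     \<Rightarrow> 'N::finite coords \<Rightarrow> 'N coords \<Rightarrow> complex^('N \<times> 'N)^('N \<times> 'N)" where
  "sminus tau eta c n a w p q = s21 tau eta c n a w p q - uminus_mat tau eta n a q"

end

theory Submission
  imports Defs "HOL-Complex_Analysis.Cauchy_Integral_Formula"
begin

text \<open>Since \<open>L\<^sup>a\<close> depends only on \<open>p\<^sup>a\<close>, \<open>q\<^sup>a\<close>, \<open>q\<^sup>a\<^sup>-\<^sup>1\<close> and \<open>c \<partial>L\<^sup>a\<^sub>i\<^sub>j/\<partial>p\<^sup>a\<^sub>m = \<delta>\<^sub>j\<^sub>m L\<^sup>a\<^sub>i\<^sub>j\<close>, the component \<open>(ik, jl)\<close> of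
  \<open>c {L\<^sup>a\<^sub>1(z), L\<^sup>b\<^sub>2(w)}\<close> is \<open>L\<^sup>a\<^sub>i\<^sub>j(z) L\<^sup>b\<^sub>k\<^sub>l(w)\<close> times the difference of the logarithmic derivatives of \<open>L\<^sup>b\<^sub>k\<^sub>l(w)\<close> in
  \<open>q\<^sup>a\<^sub>j\<close> and of \<open>L\<^sup>a\<^sub>i\<^sub>j(z)\<close> in \<open>q\<^sup>b\<^sub>l\<close>. Derivatives in the coordinates of the preceding site give exactly the
  terms with \<open>s\<^sup>\<plusminus>\<close>, because \<open>L\<close> cancels the inverse in \<open>s\<close>. For \<open>a = b\<close> the column factors of \<open>L\<close> drop
  out as well and one is left with an identity between the functions \<open>\<phi>\<close> and \<open>E\<^sub>1\<close>, which in the cases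
  \<open>i \<noteq> k, j = l\<close> and \<open>i = k, j \<noteq> l\<close> is the addition formula for \<open>E\<^sub>1\<close>, and in the case \<open>i \<noteq> k, j \<noteq> l\<close> is
  that formula combined with the three-term identity of the theta function.\<close>

section \<open>Gaussian series\<close>

lemma summable_on_exp_neg_abs_int: "(\<lambda>j::int. exp (- \<bar>real_of_int j\<bar>)) summable_on UNIV"
proof -
  have nat: "(\<lambda>k::nat. exp (- real k)) summable_on UNIV"
  proof (rule norm_summable_imp_summable_on)
    have "summable (\<lambda>k::nat. exp (-1 :: real) ^ k)"
      by (rule summable_geometric) simp
    thus "summable (\<lambda>k. norm (exp (- real k)))"
      by (simp add: exp_of_nat_mult[symmetric])
  qed
  have "(\<lambda>j::int. exp (- \<bar>real_of_int j\<bar>)) summable_on {0..}"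
    using nat
    by (subst summable_on_reindex_bij_witness[of "{0..}" int nat UNIV "\<lambda>k. exp (- real k)"]) auto
  moreover have "(\<lambda>j::int. exp (- \<bar>real_of_int j\<bar>)) summable_on {..0}"
    using nat
    by (subst summable_on_reindex_bij_witness[of "{..0}" "\<lambda>k. - int k" "\<lambda>j. nat (- j)" UNIV "\<lambda>k. exp (- real k)"]) auto
  moreover have "UNIV = {0..} \<union> {..(0::int)}"
    by auto
  ultimately show ?thesis
    using summable_on_union by metis
qed

lemma summable_on_exp_quadratic_int:
  fixes A B s :: real
  assumes "A > 0"
  shows "(\<lambda>j::int. exp (- A * (of_int j + s)\<^sup>2 + B * \<bar>of_int j + s\<bar>)) summable_on UNIV"
proof (rule summable_on_comparison_test)
  let ?C = "exp ((B + 1)\<^sup>2 / (4 * A) + \<bar>s\<bar>)"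
  show "(\<lambda>j::int. ?C * exp (- \<bar>real_of_int j\<bar>)) summable_on UNIV"
    by (intro summable_on_cmult_right summable_on_exp_neg_abs_int)
  fix j :: int
  define t where "t = \<bar>real_of_int j + s\<bar>"
  have "0 \<le> (2 * A * t - (B + 1))\<^sup>2 / (4 * A)"
    using assms by simp
  also have "\<dots> = A * t\<^sup>2 - (B + 1) * t + (B + 1)\<^sup>2 / (4 * A)"
    using assms by (simp add: field_simps power2_eq_square)
  finally have "- A * t\<^sup>2 + B * t \<le> (B + 1)\<^sup>2 / (4 * A) - t"
    by (simp add: algebra_simps)
  moreover have "t \<ge> \<bar>real_of_int j\<bar> - \<bar>s\<bar>"
    unfolding t_def by linarith
  ultimately have "- A * t\<^sup>2 + B * t \<le> ((B + 1)\<^sup>2 / (4 * A) + \<bar>s\<bar>) + - \<bar>real_of_int j\<bar>"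
    by linarith
  thus "exp (- A * (of_int j + s)\<^sup>2 + B * \<bar>of_int j + s\<bar>) \<le> ?C * exp (- \<bar>real_of_int j\<bar>)"
    unfolding exp_add[symmetric] exp_le_cancel_iff by (simp add: t_def)
qed auto

definition gauss_term :: "complex \<Rightarrow> complex \<Rightarrow> real \<Rightarrow> complex" where
  "gauss_term tau x s = exp (of_real pi * \<i> * (of_real s)\<^sup>2 * tau + 2 * of_real pi * \<i> * of_real s * x)"

lemma norm_gauss_term: "norm (gauss_term tau x s) = exp (- (pi * Im tau) * s\<^sup>2 - 2 * pi * s * Im x)"
  unfolding gauss_term_def norm_exp_eq_Re of_real_power[symmetric] by simp

lemma norm_gauss_term_le:
  assumes "\<bar>Im x\<bar> \<le> R"
  shows "norm (gauss_term tau x s) \<le> exp (- (pi * Im tau) * s\<^sup>2 + 2 * pi * R * \<bar>s\<bar>)"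
proof -
  have "- (s * Im x) \<le> \<bar>s\<bar> * \<bar>Im x\<bar>"
    using abs_ge_minus_self[of "s * Im x"] by (simp only: abs_mult)
  also have "\<dots> \<le> R * \<bar>s\<bar>"
    using mult_left_mono[OF assms abs_ge_zero[of s]] by (simp only: mult.commute)
  finally have "2 * pi * - (s * Im x) \<le> 2 * pi * (R * \<bar>s\<bar>)"
    by (intro mult_left_mono) auto
  thus ?thesis
    by (simp add: norm_gauss_term mult_ac)
qed

lemma summable_on_gauss_term:
  assumes "Im tau > 0"
  shows "(\<lambda>j. gauss_term tau x (of_int j + s)) summable_on S"
proof (rule summable_on_subset_banach)
  show "(\<lambda>j. gauss_term tau x (of_int j + s)) summable_on UNIV"
    using summable_on_exp_quadratic_int[of "pi * Im tau" s "2 * pi * \<bar>Im x\<bar>"] assms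
    by (intro abs_summable_summable[OF Infinite_Sum.abs_summable_on_comparison_test'[OF _ norm_gauss_term_le]]) auto
qed simp

lemma gauss_term_minus: "gauss_term tau (- x) (- s) = gauss_term tau x s"
  by (simp add: gauss_term_def)

lemma gauss_term_add: "gauss_term tau (x + y) s = gauss_term tau x s * exp (2 * of_real pi * \<i> * of_real s * y)"
  by (simp add: gauss_term_def exp_add[symmetric] algebra_simps)

lemma gauss_term_add_half_int: "gauss_term tau (x + 1/2) (of_int r) = (-1) powi r * gauss_term tau x (of_int r)"
  unfolding gauss_term_add using exp_power_int[of "of_real pi * \<i>" r] by (simp add: mult_ac)

lemma gauss_term_mult:
  "gauss_term tau (x + y) s * gauss_term tau (x - y) t = gauss_term (tau / 2) x (s + t) * gauss_term (tau / 2) y (s - t)"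
  unfolding gauss_term_def exp_add[symmetric]
  by (rule arg_cong[where f = exp]) (simp add: field_simps power2_eq_square)

lemma holomorphic_on_infsum_gauss_term:
  assumes "Im tau > 0"
  shows "(\<lambda>x. \<Sum>\<^sub>\<infinity>j. gauss_term tau x (of_int j + s)) holomorphic_on UNIV"
proof -
  have "(\<lambda>x. \<Sum>\<^sub>\<infinity>j. gauss_term tau x (of_int j + s)) holomorphic_on ball z 1" for z
  proof -
    define R where "R = \<bar>Im z\<bar> + 1"
    have bound: "\<bar>Im x\<bar> \<le> R" if "x \<in> cball z 1" for x
      using that abs_Im_le_cmod[of "z - x"] by (auto simp: R_def dist_norm)
    have "uniform_limit (cball z 1) (\<lambda>X x. \<Sum>j\<in>X. gauss_term tau x (of_int j + s))
        (\<lambda>x. \<Sum>\<^sub>\<infinity>j. gauss_term tau x (of_int j + s)) (finite_subsets_at_top UNIV)"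
      using summable_on_exp_quadratic_int[of "pi * Im tau" s "2 * pi * R"] assms
      by (intro Weierstrass_m_test_general[OF norm_gauss_term_le[OF bound]]) auto
    thus ?thesis
      by (rule holomorphic_uniform_limit[rotated])
        (auto simp: gauss_term_def intro!: always_eventually continuous_intros holomorphic_intros)
  qed
  thus ?thesis
    by (auto simp: holomorphic_on_open field_differentiable_def[symmetric]) (meson centre_in_ball zero_less_one)
qed

lemma has_sum_mult_Times:
  fixes f :: "'a \<Rightarrow> 'c::{real_normed_field, banach}" and g :: "'b \<Rightarrow> 'c"
  assumes "(\<lambda>x. norm (f x)) summable_on A" and "(\<lambda>y. norm (g y)) summable_on B"
  shows "((\<lambda>(x, y). f x * g y) has_sum infsum f A * infsum g B) (A \<times> B)"
proof (rule has_sum_SigmaI)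
  note summable = assms[THEN abs_summable_summable]
  show "((\<lambda>y. case (x, y) of (x, y) \<Rightarrow> f x * g y) has_sum f x * infsum g B) B" for x
    using summable by (auto intro!: has_sum_cmult_right)
  show "((\<lambda>x. f x * infsum g B) has_sum infsum f A * infsum g B) A"
    using summable by (auto intro!: has_sum_cmult_left)
  have "(\<lambda>p. norm (case p of (x, y) \<Rightarrow> f x * g y)) summable_on A \<times> B"
    using assms by (subst Infinite_Sum.abs_summable_on_Sigma_iff)
      (auto simp: norm_mult infsum_cmult_right' summable_on_cmult_right abs_mult intro!: summable_on_cmult_left)
  thus "(\<lambda>(x, y). f x * g y) summable_on A \<times> B"
    by (rule abs_summable_summable)
qed

section \<open>The odd theta function\<close>

lemma jtheta_eq_gauss_series: "jtheta tau z = - (\<Sum>\<^sub>\<infinity>j. gauss_term tau (z + 1/2) (of_int j + 1/2))"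
  by (simp add: jtheta_def gauss_term_def)

lemma jtheta_minus: "jtheta tau (- z) = - jtheta tau z"
proof -
  have "gauss_term tau (- z + 1/2) (of_int (- 1 - j) + 1/2) = - gauss_term tau (z + 1/2) (of_int j + 1/2)" for j
  proof -
    define s where "s = real_of_int j + 1/2"
    have "exp (2 * of_real pi * \<i> * of_real s) = exp (2 * of_int j * of_real pi * \<i>) * exp (of_real pi * \<i>)"
      unfolding exp_add[symmetric] by (simp add: s_def algebra_simps)
    also have "\<dots> = - 1"
      using exp_integer_2pi[of "of_int j"] by simp
    finally have "gauss_term tau (z + 1/2) s = - gauss_term tau (z - 1/2) s"
      using gauss_term_add[of tau "z - 1/2" 1 s] by (simp add: add.commute)
    moreover have "of_int (- 1 - j) + 1/2 = - s" "- z + 1/2 = - (z - 1/2)"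
      by (simp_all add: s_def)
    ultimately show ?thesis
      unfolding s_def[symmetric] by (simp only: gauss_term_minus minus_minus)
  qed
  then have "(\<Sum>\<^sub>\<infinity>j. - gauss_term tau (z + 1/2) (of_int j + 1/2))
      = (\<Sum>\<^sub>\<infinity>j. gauss_term tau (- z + 1/2) (of_int j + 1/2))"
    by (intro infsum_reindex_bij_witness[of _ "\<lambda>j. - 1 - j" "\<lambda>j. - 1 - j"]) auto
  thus ?thesis
    by (simp add: jtheta_eq_gauss_series infsum_uminus)
qed

lemma jtheta_zero [simp]: "jtheta tau 0 = 0"
  using jtheta_minus[of tau 0] by simp

locale upper_half_plane =
  fixes tau :: complex
  assumes Im_tau_pos: "Im tau > 0"
begin

abbreviation theta :: "complex \<Rightarrow> complex" where "theta \<equiv> jtheta tau"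
abbreviation E :: "complex \<Rightarrow> complex" where "E \<equiv> E1 tau"
abbreviation phi :: "complex \<Rightarrow> complex \<Rightarrow> complex" where "phi \<equiv> ellphi tau"

lemma holomorphic_on_theta: "theta holomorphic_on UNIV"
proof -
  have "(\<lambda>z. - ((\<lambda>x. \<Sum>\<^sub>\<infinity>j. gauss_term tau x (of_int j + 1/2)) \<circ> (\<lambda>z. z + 1/2)) z) holomorphic_on UNIV"
    by (intro holomorphic_on_minus holomorphic_on_compose_gen[OF _ holomorphic_on_infsum_gauss_term[OF Im_tau_pos]]
        holomorphic_intros) auto
  thus ?thesis
    by (simp add: jtheta_eq_gauss_series[abs_def] o_def)
qed

lemma has_field_derivative_theta: "(theta has_field_derivative deriv theta z) (at z)"
  using holomorphic_on_theta by (rule holomorphic_derivI) auto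

lemma has_field_derivative_theta_chain:
  assumes "(g has_field_derivative g') (at x within S)"
  shows "((\<lambda>x. theta (g x)) has_field_derivative deriv theta (g x) * g') (at x within S)"
  using has_field_derivative_theta assms by (rule DERIV_chain2)

lemma deriv_theta_minus: "deriv theta (- z) = deriv theta z"
proof -
  have "((\<lambda>x. - theta (- x)) has_field_derivative deriv theta (- z)) (at z)"
    by (auto intro!: derivative_eq_intros has_field_derivative_theta_chain)
  thus ?thesis
    using DERIV_unique[OF has_field_derivative_theta] by (simp add: jtheta_minus)
qed

lemma E_minus: "E (- z) = - E z"
  by (simp add: E1_def jtheta_minus deriv_theta_minus)

lemma E_minus_commute: "E (x - y) = - E (y - x)"
  using E_minus[of "y - x"] by simp

end

section \<open>Weierstrass' identity\<close>

text \<open>The substitution \<open>r = j + k + 1\<close>, \<open>s = j - k\<close> in the double series turns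
  \<open>jtheta (x + y) * jtheta (x - y)\<close> into the determinant of the vectors (even part, odd part) at \<open>x\<close>
  and \<open>y\<close> of a series at modulus \<open>tau/2\<close>, so Weierstrass' identity is the Pluecker relation.\<close>

definition even_gauss_series :: "complex \<Rightarrow> complex \<Rightarrow> complex" where
  "even_gauss_series tau x = (\<Sum>\<^sub>\<infinity>r\<in>{r::int. even r}. gauss_term tau x (of_int r))"

definition odd_gauss_series :: "complex \<Rightarrow> complex \<Rightarrow> complex" where
  "odd_gauss_series tau x = (\<Sum>\<^sub>\<infinity>r\<in>{r::int. odd r}. gauss_term tau x (of_int r))"

lemma even_gauss_series_add_half: "even_gauss_series tau (x + 1/2) = even_gauss_series tau x"
  unfolding even_gauss_series_def by (rule infsum_cong) (simp add: gauss_term_add_half_int)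

lemma odd_gauss_series_add_half: "odd_gauss_series tau (x + 1/2) = - odd_gauss_series tau x"
  unfolding odd_gauss_series_def infsum_uminus[symmetric]
  by (rule infsum_cong) (simp add: gauss_term_add_half_int)

lemma bij_betw_sum_diff_int:
  "bij_betw (\<lambda>(j, k). (j + k + 1, j - k)) UNIV ({r::int. even r} \<times> {r. odd r} \<union> {r. odd r} \<times> {r. even r})"
  (is "bij_betw ?f UNIV ?S")
proof (rule bij_betw_byWitness[where f' = "\<lambda>(r, s). ((r + s - 1) div 2, (r - s - 1) div 2)"])
  show "\<forall>p\<in>?S. ?f (case p of (r, s) \<Rightarrow> ((r + s - 1) div 2, (r - s - 1) div 2)) = p"
    by (auto elim!: evenE oddE)
qed auto

context upper_half_plane
begin

lemma has_sum_theta_mult: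
  "((\<lambda>(r, s). gauss_term (tau / 2) (x + 1/2) (of_int r) * gauss_term (tau / 2) y (of_int s))
    has_sum theta (x + y) * theta (x - y)) ({r. even r} \<times> {r. odd r} \<union> {r. odd r} \<times> {r. even r})"
    (is "(?product has_sum _) _")
proof -
  let ?term = "\<lambda>z j. gauss_term tau (z + 1/2) (of_int j + 1/2)"
  have "?term (x + y) j * ?term (x - y) k = ?product (j + k + 1, j - k)" for j k
    using gauss_term_mult[of tau "x + 1/2" y "of_int j + 1/2" "of_int k + 1/2"]
    by (simp add: algebra_simps)
  then have "(\<lambda>(j, k). ?term (x + y) j * ?term (x - y) k)
      = (\<lambda>p. ?product (case p of (j, k) \<Rightarrow> (j + k + 1, j - k)))"
    by auto
  moreover have "((\<lambda>(j, k). ?term (x + y) j * ?term (x - y) k) has_sum theta (x + y) * theta (x - y)) (UNIV \<times> UNIV)"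
    using has_sum_mult_Times[of "?term (x + y)" UNIV "?term (x - y)" UNIV]
      summable_on_gauss_term[OF Im_tau_pos]
    by (simp add: jtheta_eq_gauss_series summable_on_iff_abs_summable_on_complex)
  ultimately show ?thesis
    using has_sum_reindex_bij_betw[OF bij_betw_sum_diff_int, of ?product] by simp
qed

lemma theta_add_mult_diff:
  "theta (x + y) * theta (x - y)
    = even_gauss_series (tau / 2) x * odd_gauss_series (tau / 2) y
    - odd_gauss_series (tau / 2) x * even_gauss_series (tau / 2) y"
proof -
  let ?even = "{r::int. even r}" and ?odd = "{r::int. odd r}"
  let ?term = "\<lambda>x r. gauss_term (tau / 2) x (of_int r)"
  let ?product = "\<lambda>(r, s). ?term (x + 1/2) r * ?term y s"
  have "(\<lambda>r. norm (?term z r)) summable_on S" for z S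
    using summable_on_gauss_term[of "tau / 2" z 0 S] Im_tau_pos
    by (simp add: summable_on_iff_abs_summable_on_complex)
  then have has_sum_Times: "(?product has_sum infsum (?term (x + 1/2)) A * infsum (?term y) B) (A \<times> B)" for A B
    by (intro has_sum_mult_Times)
  have "(?product has_sum even_gauss_series (tau / 2) x * odd_gauss_series (tau / 2) y) (?even \<times> ?odd)"
    "(?product has_sum - odd_gauss_series (tau / 2) x * even_gauss_series (tau / 2) y) (?odd \<times> ?even)"
    using has_sum_Times[of ?even ?odd] has_sum_Times[of ?odd ?even]
    unfolding even_gauss_series_def[symmetric] odd_gauss_series_def[symmetric]
      even_gauss_series_add_half odd_gauss_series_add_half .
  then have "(?product has_sum even_gauss_series (tau / 2) x * odd_gauss_series (tau / 2) y
      + - odd_gauss_series (tau / 2) x * even_gauss_series (tau / 2) y) (?even \<times> ?odd \<union> ?odd \<times> ?even)"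
    by (rule has_sum_Un_disjoint) auto
  from has_sum_unique[OF has_sum_theta_mult this] show ?thesis
    by simp
qed

lemma theta_weierstrass:
  "theta (x + y) * theta (x - y) * (theta (u + v) * theta (u - v))
    = theta (x + u) * theta (x - u) * (theta (y + v) * theta (y - v))
    - theta (x + v) * theta (x - v) * (theta (y + u) * theta (y - u))"
  unfolding theta_add_mult_diff by (simp add: algebra_simps)

lemma theta_fay:
  "theta (z + A + C) * theta (w + B + C) * (theta (A + B) * theta (z - w))
    = theta (z - w + A) * theta (z + C) * (theta (w + A + B + C) * theta B)
    + theta (z - w - B) * theta (z + A + B + C) * (theta (w + C) * theta A)"
proof -
  define x y u v where "x = (z + w + A + B + 2 * C) / 2" and "y = (z - w + A - B) / 2"
    and "u = (A + B + z - w) / 2" and "v = (A + B - z + w) / 2"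
  have "x + y = z + A + C" "x - y = w + B + C" "u + v = A + B" "u - v = z - w"
    "x + u = z + A + B + C" "x - u = w + C" "y + v = A" "y - v = z - w - B"
    "x + v = w + A + B + C" "x - v = z + C" "y + u = z - w + A" "y - u = - B"
    by (simp_all add: x_def y_def u_def v_def field_simps)
  then show ?thesis
    using theta_weierstrass[of x y u v] by (simp add: jtheta_minus mult_ac)
qed

text \<open>The derivative of \<open>theta_fay\<close> in \<open>z\<close> at \<open>z = 0\<close>, for \<open>w = 0\<close>.\<close>

lemma E_addition:
  assumes nonzero: "theta A \<noteq> 0" "theta B \<noteq> 0" "theta C \<noteq> 0" "theta (A + B + C) \<noteq> 0"
  shows "E A + E B + E C - E (A + B + C)
    = deriv theta 0 * theta (A + B) * theta (B + C) * theta (A + C)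
      / (theta A * theta B * theta C * theta (A + B + C))"
proof -
  note [derivative_intros] = has_field_derivative_theta_chain
  have lhs: "((\<lambda>z. theta (z + A + C) * theta (B + C) * (theta (A + B) * theta z))
      has_field_derivative theta (A + C) * theta (B + C) * (theta (A + B) * deriv theta 0)) (at 0)"
    by (rule derivative_eq_intros refl)+ simp
  have "((\<lambda>z. theta (z + A) * theta (z + C) * (theta (A + B + C) * theta B)
          + theta (z - B) * theta (z + A + B + C) * (theta C * theta A))
      has_field_derivative (deriv theta A * theta C + theta A * deriv theta C) * theta (A + B + C) * theta B
        + (deriv theta B * theta (A + B + C) - theta B * deriv theta (A + B + C)) * theta C * theta A) (at 0)"
    by (rule derivative_eq_intros refl)+ (simp add: jtheta_minus deriv_theta_minus algebra_simps)
  then have "theta (A + C) * theta (B + C) * (theta (A + B) * deriv theta 0)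
     = (deriv theta A * theta C + theta A * deriv theta C) * theta (A + B + C) * theta B
        + (deriv theta B * theta (A + B + C) - theta B * deriv theta (A + B + C)) * theta C * theta A"
    using DERIV_unique[OF lhs] theta_fay[of _ A C 0 B] by simp
  thus ?thesis
    using nonzero by (simp add: E1_def field_simps)
qed

section \<open>Identities for the Kronecker function\<close>

lemma phi_minus: "phi (- z) (- u) = - phi z u"
  using jtheta_minus[of tau "z + u"] by (simp add: ellphi_def jtheta_minus)

lemma phi_minus_commute: "phi (z - w) (x - y) = - phi (w - z) (y - x)"
  using phi_minus[of "w - z" "y - x"] by simp

lemma phi_mult_E_diff:
  assumes "theta (z - w) \<noteq> 0" "theta (a - b) \<noteq> 0" "theta (z + a) \<noteq> 0" "theta (w + b) \<noteq> 0"
  shows "phi z a * phi w b * (E (z - w) + E (a - b) + E (w + b) - E (z + a))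
    = phi (z - w) (a - b) * phi z b * phi w a"
proof -
  have sums: "(z - w) + (a - b) + (w + b) = z + a" "(a - b) + (w + b) = w + a" "(z - w) + (w + b) = z + b"
    by simp_all
  show ?thesis
    using E_addition[of "z - w" "a - b" "w + b", unfolded sums] assms
    by (simp add: ellphi_def ac_simps)
qed

lemma phi_mult_E_add:
  assumes nonzero: "theta (z - w) \<noteq> 0" "theta A \<noteq> 0" "theta B \<noteq> 0" "theta C \<noteq> 0"
      "theta (A + B + C) \<noteq> 0" "theta (A + C) \<noteq> 0" "theta (B + C) \<noteq> 0"
  shows "phi z (A + C) * phi w (B + C) * (E A + E B + E C - E (A + B + C))
    = phi (z - w) A * phi z C * phi w (A + B + C)
    + phi (w - z) B * phi z (A + B + C) * phi w C"
proof -
  define d where "d = deriv theta 0 ^ 3 / (theta z * theta w * theta (z - w) * theta A * theta B * theta C * theta (A + B + C))"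
  have "phi z (A + C) * phi w (B + C) * (E A + E B + E C - E (A + B + C))
    = d * (theta (z + A + C) * theta (w + B + C) * (theta (A + B) * theta (z - w)))"
    unfolding E_addition[OF nonzero(2-5)] d_def using nonzero by (simp add: ellphi_def power3_eq_cube ac_simps)
  also have "\<dots> = d * (theta (z - w + A) * theta (z + C) * (theta (w + A + B + C) * theta B))
    + d * (theta (z - w - B) * theta (z + A + B + C) * (theta (w + C) * theta A))"
    unfolding theta_fay by (rule distrib_left)
  also have "d * (theta (z - w + A) * theta (z + C) * (theta (w + A + B + C) * theta B))
    = phi (z - w) A * phi z C * phi w (A + B + C)"
    using nonzero by (simp add: d_def ellphi_def power3_eq_cube ac_simps)
  also have "d * (theta (z - w - B) * theta (z + A + B + C) * (theta (w + C) * theta A))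
    = phi (w - z) B * phi z (A + B + C) * phi w C"
    using phi_minus[of "z - w" "- B"] nonzero by (simp add: d_def ellphi_def jtheta_minus power3_eq_cube ac_simps)
  finally show ?thesis .
qed

end

section \<open>Logarithmic derivatives\<close>

definition has_log_derivative :: "('a::real_normed_field \<Rightarrow> 'a) \<Rightarrow> 'a \<Rightarrow> 'a \<Rightarrow> bool" where
  "has_log_derivative f D x \<longleftrightarrow> (f has_field_derivative f x * D) (at x)"

lemma has_log_derivative_const: "has_log_derivative (\<lambda>x. k) 0 x"
  by (simp add: has_log_derivative_def)

lemma has_log_derivative_mult:
  assumes "has_log_derivative f D x" "has_log_derivative g D' x"
  shows "has_log_derivative (\<lambda>x. f x * g x) (D + D') x"
  unfolding has_log_derivative_def
  using DERIV_mult[OF assms[unfolded has_log_derivative_def]]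
  by (rule DERIV_cong) (simp add: algebra_simps)

lemma has_log_derivative_divide:
  assumes "has_log_derivative f D x" "has_log_derivative g D' x" "g x \<noteq> 0"
  shows "has_log_derivative (\<lambda>x. f x / g x) (D - D') x"
  unfolding has_log_derivative_def
  using DERIV_divide[OF assms[unfolded has_log_derivative_def]]
  by (rule DERIV_cong) (use assms(3) in \<open>simp add: field_simps\<close>)

lemma has_log_derivative_prod:
  assumes "\<And>l. l \<in> S \<Longrightarrow> has_log_derivative (f l) (D l) x" "\<And>l. l \<in> S \<Longrightarrow> f l x \<noteq> 0"
  shows "has_log_derivative (\<lambda>x. \<Prod>l\<in>S. f l x) (\<Sum>l\<in>S. D l) x"
  using has_field_derivative_prod'[of S f x "\<lambda>l. f l x * D l"] assms
  by (simp add: has_log_derivative_def)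

context upper_half_plane
begin

lemma has_log_derivative_theta:
  assumes "(g has_field_derivative g') (at x)" "theta (g x) \<noteq> 0"
  shows "has_log_derivative (\<lambda>x. theta (g x)) (E (g x) * g') x"
  unfolding has_log_derivative_def using has_field_derivative_theta_chain[OF assms(1)]
  by (rule DERIV_cong) (use assms(2) in \<open>simp add: E1_def\<close>)

definition dlog_phi :: "complex \<Rightarrow> complex \<Rightarrow> complex" where
  "dlog_phi z u = E (z + u) - E u"

lemma has_log_derivative_phi:
  assumes inner: "(g has_field_derivative g') (at x)"
    and nonzero: "theta z \<noteq> 0" "theta (g x) \<noteq> 0" "theta (z + g x) \<noteq> 0"
  shows "has_log_derivative (\<lambda>x. phi z (g x)) (dlog_phi z (g x) * g') x"
proof -
  have "((\<lambda>x. z + g x) has_field_derivative g') (at x)"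
    using DERIV_add[OF DERIV_const inner] by simp
  then have "has_log_derivative (\<lambda>x. phi z (g x)) ((0 + E (z + g x) * g') - (0 + E (g x) * g')) x"
    unfolding ellphi_def
    by (intro has_log_derivative_divide has_log_derivative_mult has_log_derivative_theta
        has_log_derivative_const) (use inner nonzero in auto)
  thus ?thesis
    by (simp add: dlog_phi_def algebra_simps)
qed

end

section \<open>Tensor products of matrices\<close>

lemma tensor_eqI:
  assumes "\<And>i k j l. M $ (i, k) $ (j, l) = N $ (i, k) $ (j, l)"
  shows "M = N"
  using assms by (simp add: vec_eq_iff)

lemma tens_nth [simp]: "tens A B $ (i, k) $ (j, l) = A $ i $ j * B $ k $ l"
  by (simp add: tens_def)

lemma smat_nth [simp]: "smat x M $ i $ j = x * M $ i $ j"
  by (simp add: smat_def)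

lemma munit_nth: "munit i j $ r $ s = (if r = i then if s = j then 1 else 0 else 0)"
  by (simp add: munit_def)

lemma sum_if_const: "(\<Sum>x\<in>A. if P then f x else 0) = (if P then sum f A else 0)"
  by simp

lemmas sum_delta_simps = mult_delta_left mult_delta_right sum_if_const

lemma sum_UNIV_Pair: "sum f UNIV = (\<Sum>i\<in>UNIV. \<Sum>k\<in>UNIV. f (i, k))"
  by (simp add: sum.cartesian_product)

lemma tens_mult_tens: "tens A B ** tens C D = tens (A ** C) (B ** D)"
  by (rule tensor_eqI) (simp add: matrix_matrix_mult_def sum_UNIV_Pair sum_product mult_ac)

lemma tens_mat_1_mult_nth:
  "(tens A (mat 1) ** M) $ (i, k) $ y = (\<Sum>m\<in>UNIV. A $ i $ m * M $ (m, k) $ y)"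
  by (simp add: matrix_matrix_mult_def tens_def mat_def sum_UNIV_Pair sum_delta_simps)

lemma mat_1_tens_mult_nth:
  "(tens (mat 1) B ** M) $ (i, k) $ y = (\<Sum>m\<in>UNIV. B $ k $ m * M $ (i, m) $ y)"
  by (simp add: matrix_matrix_mult_def tens_def mat_def sum_UNIV_Pair sum_delta_simps)

lemma mult_mat_1_tens_nth:
  "(M ** tens (mat 1) B) $ x $ (j, l) = (\<Sum>m\<in>UNIV. M $ x $ (j, m) * B $ m $ l)"
  by (simp add: matrix_matrix_mult_def tens_def mat_def sum_UNIV_Pair sum_delta_simps)

definition tensor_flip :: "complex^('N::finite \<times> 'N)^('N \<times> 'N) \<Rightarrow> complex^('N \<times> 'N)^('N \<times> 'N)" where
  "tensor_flip M = (\<chi> x y. M $ prod.swap x $ prod.swap y)"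

lemma tensor_flip_nth [simp]: "tensor_flip M $ (i, k) $ (j, l) = M $ (k, i) $ (l, j)"
  by (simp add: tensor_flip_def)

lemma tensor_flip_flip: "tensor_flip (tensor_flip M) = M"
  by (rule tensor_eqI) simp

lemma tensor_flip_tens: "tensor_flip (tens A B) = tens B A"
  by (rule tensor_eqI) simp

lemma tensor_flip_mult: "tensor_flip (M ** N) = tensor_flip M ** tensor_flip N"
proof (rule tensor_eqI)
  fix i k j l
  show "tensor_flip (M ** N) $ (i, k) $ (j, l) = (tensor_flip M ** tensor_flip N) $ (i, k) $ (j, l)"
    by (simp add: matrix_matrix_mult_def sum_UNIV_Pair) (rule sum.swap)
qed

lemma tensor_flip_add: "tensor_flip (M + N) = tensor_flip M + tensor_flip N"
  by (rule tensor_eqI) simp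

lemma tensor_flip_smat: "tensor_flip (smat x M) = smat x (tensor_flip M)"
  by (rule tensor_eqI) simp

lemma tensor_flip_sum: "tensor_flip (\<Sum>i\<in>S. M i) = (\<Sum>i\<in>S. tensor_flip (M i))"
  by (rule tensor_eqI) simp

lemma matrix_mult_matrix_inv_right:
  assumes "invertible A"
  shows "A ** matrix_inv A = mat 1"
  using someI_ex[OF assms[unfolded invertible_def]] unfolding matrix_inv_def by blast

section \<open>The matrices in the bracket relation\<close>

lemma L2_eq_tensor_flip_L1: "L2 tau eta c n a z p q = tensor_flip (L1 tau eta c n a z p q)"
  by (simp add: L1_def L2_def tensor_flip_tens)

lemma sminus_eq_tensor_flip_splus: "sminus tau eta c n a z p q = tensor_flip (splus tau eta c n a z p q)"
proof -
  have "- uminus_mat tau eta n a q = tensor_flip (uplus tau eta n a q)"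
    unfolding uminus_mat_def uplus_def minus_minus tensor_flip_sum tensor_flip_smat tensor_flip_tens
    by (rule sum.swap)
  moreover have "s21 tau eta c n a z p q = tensor_flip (s12 tau eta c n a z p q)"
    by (simp add: s12_def s21_def tensor_flip_sum tensor_flip_smat tensor_flip_tens)
  ultimately show ?thesis
    by (simp add: splus_def sminus_def tensor_flip_add)
qed

lemma s12_nth:
  "s12 tau eta c n a z p q $ (i, k) $ (j, l)
    = (if k = l then matrix_inv (Lmat tau eta c n a z p q) $ i $ k * Dmat tau eta c n a z p q $ k $ j else 0)"
  by (simp add: s12_def munit_nth sum_delta_simps)

lemma uplus_nth:
  "uplus tau eta n a q $ (i, k) $ (j, l) = (if i = j \<and> k = l then E1 tau (q (cprev n a) k - q a i + eta) else 0)"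
  by (simp add: uplus_def munit_nth sum_delta_simps)

context upper_half_plane
begin

definition r_swap :: "complex \<Rightarrow> ('N \<Rightarrow> complex) \<Rightarrow> 'N \<Rightarrow> 'N \<Rightarrow> complex" where
  "r_swap z v i j = (if i = j then 0 else phi z (v i - v j))"

definition r_diag :: "complex \<Rightarrow> ('N \<Rightarrow> complex) \<Rightarrow> 'N \<Rightarrow> 'N \<Rightarrow> complex" where
  "r_diag z v i j = (if i = j then E z else - E (v i - v j))"

lemma rmat_eq:
  "rmat tau a q z w
    = (\<Sum>i\<in>UNIV. \<Sum>j\<in>UNIV. smat (r_swap (z - w) (q a) i j) (tens (munit i j) (munit j i)))
    + (\<Sum>i\<in>UNIV. \<Sum>j\<in>UNIV. smat (r_diag (z - w) (q a) i j) (tens (munit i i) (munit j j)))"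
proof -
  have "(\<Sum>j\<in>UNIV - {i}. smat (phi (z - w) (q a i - q a j)) (tens (munit i j) (munit j i)))
      = (\<Sum>j\<in>UNIV. smat (r_swap (z - w) (q a) i j) (tens (munit i j) (munit j i)))" for i
    by (rule sum.mono_neutral_cong_left) (auto simp: r_swap_def vec_eq_iff)
  moreover have "(\<Sum>j\<in>UNIV. smat (r_diag (z - w) (q a) i j) (tens (munit i i) (munit j j)))
      = smat (E (z - w)) (tens (munit i i) (munit i i))
        - (\<Sum>j\<in>UNIV - {i}. smat (E (q a i - q a j)) (tens (munit i i) (munit j j)))" for i
    by (simp add: sum.remove[of UNIV i] r_diag_def vec_eq_iff sum_negf[symmetric])
  moreover have "smat (E (z - w)) (\<Sum>i\<in>UNIV. tens (munit i i) (munit i i))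
      = (\<Sum>i\<in>UNIV. smat (E (z - w)) (tens (munit i i) (munit i i :: complex^'a^'a)))"
    by (simp add: vec_eq_iff sum_distrib_left)
  ultimately show ?thesis
    by (simp add: rmat_def sum_subtractf)
qed

lemma rmat_nth:
  "rmat tau a q z w $ (i, k) $ (j, l)
    = (if i = l then if k = j then r_swap (z - w) (q a) i k else 0 else 0)
      + (if i = j then if k = l then r_diag (z - w) (q a) i k else 0 else 0)"
  by (simp add: rmat_eq munit_nth sum_delta_simps)

lemma tens_mult_rmat_nth:
  "(tens A B ** rmat tau a q z w) $ (i, k) $ (j, l)
    = A $ i $ l * B $ k $ j * r_swap (z - w) (q a) l j + A $ i $ j * B $ k $ l * r_diag (z - w) (q a) j l"
  by (simp add: matrix_matrix_mult_def sum_UNIV_Pair rmat_nth distrib_left sum.distrib sum_delta_simps)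

lemma rmat_mult_tens_nth:
  "(rmat tau a q z w ** tens A B) $ (i, k) $ (j, l)
    = r_swap (z - w) (q a) i k * (A $ k $ j * B $ i $ l) + r_diag (z - w) (q a) i k * (A $ i $ j * B $ k $ l)"
  by (simp add: matrix_matrix_mult_def sum_UNIV_Pair rmat_nth distrib_right sum.distrib sum_delta_simps)

end

section \<open>The Poisson bracket of the Lax matrices\<close>

lemma cprev_mem: "a \<in> {1..n} \<Longrightarrow> cprev n a \<in> {1..n}"
  by (auto simp: cprev_def)

lemma eq_cprev_iff_eq_cnext:
  assumes "a \<in> {1..n}" "b \<in> {1..n}"
  shows "b = cprev n a \<longleftrightarrow> a = cnext n b"
  using assms by (auto simp: cprev_def cnext_def)

lemma pb_single_momentum:
  assumes dp_f: "\<And>d m. dp d m f p q = of_bool (m = j) * of_bool (d = a) * F"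
    and dp_g: "\<And>d m. dp d m g p q = of_bool (m = l) * of_bool (d = b) * G"
    and sites: "a \<in> {1..n}" "b \<in> {1..n}"
  shows "pb n f g p q = F * dq a j g p q - G * dq b l f p q"
proof -
  have single: "(\<Sum>d\<in>{1..n}. \<Sum>m\<in>UNIV. of_bool (m = s) * of_bool (d = e) * x * h d m) = x * h e s"
    if "e \<in> {1..n}" for e x and s :: 'a and h :: "nat \<Rightarrow> 'a \<Rightarrow> complex"
    using that by (simp add: of_bool_def sum_delta_simps mult.assoc)
  have "pb n f g p q = (\<Sum>d\<in>{1..n}. \<Sum>m\<in>UNIV. of_bool (m = j) * of_bool (d = a) * F * dq d m g p q)
      - (\<Sum>d\<in>{1..n}. \<Sum>m\<in>UNIV. of_bool (m = l) * of_bool (d = b) * G * dq d m f p q)"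
    unfolding pb_def dp_f dp_g sum_subtractf[symmetric] by (simp only: mult_ac)
  thus ?thesis
    unfolding single[OF sites(1)] single[OF sites(2)] .
qed

lemma dp_Lmat:
  assumes "c \<noteq> 0"
  shows "dp d m (\<lambda>p q. Lmat tau eta c n a z p q $ i $ j) p q
    = of_bool (m = j) * of_bool (d = a) * (Lmat tau eta c n a z p q $ i $ j / c)"
proof -
  define K where "K = Lmat tau eta c n a z (\<lambda>_ _. 0) q $ i $ j"
  have Lmat_eq: "Lmat tau eta c n a z p q $ i $ j = K * exp (p a j / c)" for p
    by (simp add: K_def Lmat_def)
  have "((\<lambda>x. K * exp ((p(d := (p d)(m := x))) a j / c)) has_field_derivative
      of_bool (m = j) * of_bool (d = a) * (K * exp (p a j / c) / c)) (at (p d m))"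
    using assms by (cases "d = a"; cases "m = j") (auto intro!: derivative_eq_intros)
  from DERIV_imp_deriv[OF this] show ?thesis
    unfolding dp_def Lmat_eq .
qed

locale elliptic_chain = upper_half_plane tau for tau +
  fixes eta c :: complex and n :: nat and p q :: "'N::finite coords"
  assumes c_nonzero: "c \<noteq> 0"
    and theta_eta_nonzero: "theta (- eta) \<noteq> 0"
    and theta_shift_nonzero: "d \<in> {1..n} \<Longrightarrow> theta (q (cprev n d) i - q d j + eta) \<noteq> 0"
    and theta_diff_nonzero: "d \<in> {1..n} \<Longrightarrow> i \<noteq> j \<Longrightarrow> theta (q d i - q d j) \<noteq> 0"
begin

abbreviation L :: "nat \<Rightarrow> complex \<Rightarrow> complex^'N^'N" where
  "L a z \<equiv> Lmat tau eta c n a z p q"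

abbreviation u :: "nat \<Rightarrow> 'N \<Rightarrow> 'N \<Rightarrow> complex" where
  "u a i j \<equiv> q (cprev n a) i - q a j + eta"

abbreviation L\<^sub>1 :: "nat \<Rightarrow> complex \<Rightarrow> complex^('N \<times> 'N)^('N \<times> 'N)" where
  "L\<^sub>1 a z \<equiv> L1 tau eta c n a z p q"

abbreviation L\<^sub>2 :: "nat \<Rightarrow> complex \<Rightarrow> complex^('N \<times> 'N)^('N \<times> 'N)" where
  "L\<^sub>2 a z \<equiv> L2 tau eta c n a z p q"

abbreviation s_plus :: "nat \<Rightarrow> complex \<Rightarrow> complex^('N \<times> 'N)^('N \<times> 'N)" where
  "s_plus a z \<equiv> splus tau eta c n a z p q"

abbreviation s_minus :: "nat \<Rightarrow> complex \<Rightarrow> complex^('N \<times> 'N)^('N \<times> 'N)" where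
  "s_minus a z \<equiv> sminus tau eta c n a z p q"

definition regular :: "nat \<Rightarrow> complex \<Rightarrow> bool" where
  "regular a z \<longleftrightarrow> theta z \<noteq> 0 \<and> (\<forall>i j. theta (z + u a i j) \<noteq> 0)"

text \<open>The logarithmic derivatives of \<open>L\<^sup>a\<^sub>i\<^sub>j(z)\<close> in \<open>q\<^sup>a\<^sup>-\<^sup>1\<^sub>m\<close> and in \<open>q\<^sup>a\<^sub>m\<close>, taken as if the two families of
  coordinates were independent; for \<open>n = 1\<close> they coincide and the true derivative is the sum.\<close>

definition dlog_prev :: "nat \<Rightarrow> complex \<Rightarrow> 'N \<Rightarrow> 'N \<Rightarrow> 'N \<Rightarrow> complex" where
  "dlog_prev a z m i j = of_bool (m = i) * dlog_phi z (u a i j) + E (u a m j)"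

definition dlog_site :: "nat \<Rightarrow> complex \<Rightarrow> 'N \<Rightarrow> 'N \<Rightarrow> 'N \<Rightarrow> complex" where
  "dlog_site a z m i j = (if m = j
      then - dlog_phi z (u a i j) - (\<Sum>l\<in>UNIV. E (u a l j)) - (\<Sum>l\<in>UNIV - {j}. E (q a j - q a l))
      else E (q a j - q a m))"

lemma sum_dlog_prev_mult:
  "(\<Sum>m\<in>UNIV. dlog_prev a z m i j * v m) = dlog_phi z (u a i j) * v i + (\<Sum>m\<in>UNIV. E (u a m j) * v m)"
  by (simp add: dlog_prev_def distrib_right sum.distrib mult.assoc)

lemma sum_dlog_site_mult:
  "(\<Sum>m\<in>UNIV. dlog_site a z m i j * v m)
    = (- dlog_phi z (u a i j) - (\<Sum>l\<in>UNIV. E (u a l j)) - (\<Sum>l\<in>UNIV - {j}. E (q a j - q a l))) * v j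
      + (\<Sum>l\<in>UNIV - {j}. E (q a j - q a l) * v l)"
  by (simp add: sum.remove[of UNIV j] dlog_site_def)

lemma has_log_derivative_Lmat:
  assumes curve: "\<And>d m. ((\<lambda>t. Q t d m) has_field_derivative Q' d m) (at t)" "Q t = q"
    and site: "a \<in> {1..n}" and regular: "regular a z"
  shows "has_log_derivative (\<lambda>t. Lmat tau eta c n a z p (Q t) $ i $ j)
    ((\<Sum>m\<in>UNIV. dlog_site a z m i j * Q' a m) + (\<Sum>m\<in>UNIV. dlog_prev a z m i j * Q' (cprev n a) m)) t"
proof -
  let ?x' = "Q' (cprev n a)" and ?y' = "Q' a"
  have derivs: "((\<lambda>t. Q t (cprev n a) i - Q t a j + eta) has_field_derivative ?x' i - ?y' j) (at t)"
    "((\<lambda>t. Q t a j - Q t (cprev n a) l - eta) has_field_derivative ?y' j - ?x' l) (at t)"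
    "((\<lambda>t. Q t a j - Q t a l) has_field_derivative ?y' j - ?y' l) (at t)" for l
    by (auto intro!: derivative_eq_intros curve(1))
  have neg_shift: "q a j - q (cprev n a) l - eta = - u a l j" for l
    by simp
  have nonzero: "theta z \<noteq> 0" "theta (u a l j) \<noteq> 0" "theta (z + u a i j) \<noteq> 0"
    "m \<in> UNIV - {j} \<Longrightarrow> theta (q a j - q a m) \<noteq> 0" for l m
    using regular theta_shift_nonzero[OF site] theta_diff_nonzero[OF site] by (auto simp: regular_def)
  have nonzero_neg: "theta (- u a l j) \<noteq> 0" for l
    unfolding jtheta_minus using nonzero(2) by simp
  have "has_log_derivative (\<lambda>t. Lmat tau eta c n a z p (Q t) $ i $ j)
    (dlog_phi z (Q t (cprev n a) i - Q t a j + eta) * (?x' i - ?y' j)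
      + (\<Sum>l\<in>UNIV. E (Q t a j - Q t (cprev n a) l - eta) * (?y' j - ?x' l))
      - (0 + (\<Sum>l\<in>UNIV - {j}. E (Q t a j - Q t a l) * (?y' j - ?y' l))) + 0) t"
    unfolding Lmat_def vec_lambda_beta
    by (intro has_log_derivative_mult has_log_derivative_divide has_log_derivative_const
        has_log_derivative_prod has_log_derivative_phi has_log_derivative_theta derivs; (unfold curve(2) neg_shift)?)
      (use nonzero nonzero_neg theta_eta_nonzero in \<open>auto\<close>)
  thus ?thesis
    unfolding sum_dlog_prev_mult sum_dlog_site_mult curve(2) neg_shift E_minus
    by (simp add: algebra_simps sum.distrib sum_subtractf sum_negf sum_distrib_left)
qed

lemma dq_Lmat:
  assumes "a \<in> {1..n}" and "regular a z"
  shows "dq d m (\<lambda>p q. Lmat tau eta c n a z p q $ i $ j) p q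
    = L a z $ i $ j * (of_bool (d = a) * dlog_site a z m i j + of_bool (d = cprev n a) * dlog_prev a z m i j)"
proof -
  let ?Q = "\<lambda>t. q(d := (q d)(m := t))"
  have "((\<lambda>t. ?Q t e k) has_field_derivative of_bool (k = m) * of_bool (d = e)) (at (q d m))" for e k
    by (cases "e = d"; cases "k = m") auto
  then have "has_log_derivative (\<lambda>t. Lmat tau eta c n a z p (?Q t) $ i $ j)
    ((\<Sum>k\<in>UNIV. dlog_site a z k i j * (of_bool (k = m) * of_bool (d = a)))
      + (\<Sum>k\<in>UNIV. dlog_prev a z k i j * (of_bool (k = m) * of_bool (d = cprev n a)))) (q d m)"
    using assms by (intro has_log_derivative_Lmat) simp_all
  from this[unfolded has_log_derivative_def, THEN DERIV_imp_deriv] show ?thesis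
    by (simp add: dq_def of_bool_def mult_delta_left mult_delta_right)
qed

lemma pb_Lmat:
  assumes sites: "a \<in> {1..n}" "b \<in> {1..n}" and regular: "regular a z" "regular b w"
  shows "c * pb n (\<lambda>p q. Lmat tau eta c n a z p q $ i $ j) (\<lambda>p q. Lmat tau eta c n b w p q $ k $ l) p q
    = L a z $ i $ j * L b w $ k $ l
      * (of_bool (a = b) * (dlog_site b w j k l - dlog_site b z l i j)
        + of_bool (a = cprev n b) * dlog_prev b w j k l - of_bool (a = cnext n b) * dlog_prev a z l i j)"
proof -
  let ?A = "L a z $ i $ j" and ?B = "L b w $ k $ l"
  have "c * pb n (\<lambda>p q. Lmat tau eta c n a z p q $ i $ j) (\<lambda>p q. Lmat tau eta c n b w p q $ k $ l) p q
      = ?A * dq a j (\<lambda>p q. Lmat tau eta c n b w p q $ k $ l) p q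
        - ?B * dq b l (\<lambda>p q. Lmat tau eta c n a z p q $ i $ j) p q"
    using c_nonzero by (subst pb_single_momentum[OF dp_Lmat dp_Lmat sites]) (simp_all add: algebra_simps)
  also have "\<dots> = ?A * ?B * (of_bool (a = b) * dlog_site b w j k l + of_bool (a = cprev n b) * dlog_prev b w j k l
      - (of_bool (b = a) * dlog_site a z l i j + of_bool (b = cprev n a) * dlog_prev a z l i j))"
    unfolding dq_Lmat[OF sites(1) regular(1)] dq_Lmat[OF sites(2) regular(2)] by (simp only: right_diff_distrib mult_ac)
  also have "b = cprev n a \<longleftrightarrow> a = cnext n b"
    using sites by (rule eq_cprev_iff_eq_cnext)
  finally show ?thesis
    by (cases "a = b") (simp_all add: algebra_simps)
qed

section \<open>Components of the bracket relation\<close>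

lemma Dmat_nth: "Dmat tau eta c n a z p q $ i $ j = L a z $ i $ j * dlog_phi z (u a i j)"
  by (simp add: Dmat_def dlog_phi_def algebra_simps)

lemma L1_splus_nth:
  assumes "invertible (L a z)"
  shows "(L\<^sub>1 a z ** s_plus a z) $ (i, k) $ (j, l)
    = (if k = l then L a z $ i $ j * dlog_prev a z l i j else 0)"
proof -
  let ?inv = "matrix_inv (L a z)" and ?D = "Dmat tau eta c n a z p q"
  have "(\<Sum>m\<in>UNIV. L a z $ i $ m * (?inv $ m $ k * ?D $ k $ j)) = (if k = i then ?D $ i $ j else 0)" for k
  proof -
    have "(\<Sum>m\<in>UNIV. L a z $ i $ m * (?inv $ m $ k * ?D $ k $ j)) = (L a z ** ?inv) $ i $ k * ?D $ k $ j"
      by (simp add: matrix_matrix_mult_def sum_distrib_right mult.assoc)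
    thus ?thesis
      by (simp add: matrix_mult_matrix_inv_right[OF assms] mat_def)
  qed
  then have "(L\<^sub>1 a z ** s_plus a z) $ (i, k) $ (j, l)
      = (if k = l then (if k = i then ?D $ i $ j else 0) + L a z $ i $ j * E (u a k j) else 0)"
    by (simp add: L1_def splus_def tens_mat_1_mult_nth s12_nth uplus_nth distrib_left sum.distrib
        mult_delta_right)
  thus ?thesis
    by (simp add: Dmat_nth dlog_prev_def distrib_left)
qed

lemma L1_splus_L2_nth:
  assumes "invertible (L a z)"
  shows "(L\<^sub>1 a z ** s_plus a z ** L\<^sub>2 b w) $ (i, k) $ (j, l)
    = L a z $ i $ j * L b w $ k $ l * dlog_prev a z k i j"
  by (simp add: L2_def mult_mat_1_tens_nth L1_splus_nth[OF assms] mult_delta_left)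

lemma L1_mult_L2: "L\<^sub>1 a z ** L\<^sub>2 b w = tens (L a z) (L b w)"
  and L2_mult_L1: "L\<^sub>2 b w ** L\<^sub>1 a z = tens (L a z) (L b w)"
  by (simp_all add: L1_def L2_def tens_mult_tens)

lemma L1_L2_splus_nth:
  assumes "invertible (L a z)"
  shows "(L\<^sub>1 a z ** L\<^sub>2 b w ** s_plus a z) $ (i, k) $ (j, l)
    = L a z $ i $ j * L b w $ k $ l * dlog_prev a z l i j"
  unfolding L1_mult_L2 L2_mult_L1[symmetric] matrix_mul_assoc[symmetric]
  by (simp add: L2_def mat_1_tens_mult_nth L1_splus_nth[OF assms] mult_delta_right)

lemma L2_sminus_L1_nth:
  assumes "invertible (L b w)"
  shows "(L\<^sub>2 b w ** s_minus b w ** L\<^sub>1 a z) $ (i, k) $ (j, l)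
    = L a z $ i $ j * L b w $ k $ l * dlog_prev b w i k l"
proof -
  have "L\<^sub>2 b w ** s_minus b w ** L\<^sub>1 a z = tensor_flip (L\<^sub>1 b w ** s_plus b w ** L\<^sub>2 a z)"
    by (simp add: tensor_flip_mult L2_eq_tensor_flip_L1 sminus_eq_tensor_flip_splus tensor_flip_flip)
  thus ?thesis
    by (simp add: L1_splus_L2_nth[OF assms])
qed

lemma L1_L2_sminus_nth:
  assumes "invertible (L b w)"
  shows "(L\<^sub>1 a z ** L\<^sub>2 b w ** s_minus b w) $ (i, k) $ (j, l)
    = L a z $ i $ j * L b w $ k $ l * dlog_prev b w j k l"
proof -
  have "L\<^sub>1 a z ** L\<^sub>2 b w ** s_minus b w = tensor_flip (L\<^sub>1 b w ** L\<^sub>2 a z ** s_plus b w)"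
    by (simp add: L1_mult_L2 tensor_flip_mult tensor_flip_tens sminus_eq_tensor_flip_splus)
  thus ?thesis
    by (simp add: L1_L2_splus_nth[OF assms])
qed

definition exchange_coeff :: "nat \<Rightarrow> complex \<Rightarrow> complex \<Rightarrow> 'N \<Rightarrow> 'N \<Rightarrow> 'N \<Rightarrow> 'N \<Rightarrow> complex" where
  "exchange_coeff a z w i j k l =
     r_diag (z - w) (q (cprev n a)) i k - r_diag (z - w) (q a) j l
     + dlog_site a w j k l - dlog_site a z l i j - dlog_prev a z k i j + dlog_prev a w i k l"

lemma exchange_coeff_eq:
  "exchange_coeff a z w i j k l =
    (if j = l
     then if i = k then 0
       else - (E (z - w) + E (q (cprev n a) i - q (cprev n a) k) + E (w + u a k j) - E (z + u a i j))
     else if i = k then E (z - w) + E (q a l - q a j) + E (w + u a i l) - E (z + u a i j)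
       else E (q a l - q a j) + E (q (cprev n a) k - q (cprev n a) i) + E (u a i l) - E (u a k j))"
  using E_minus_commute[of "q a j" "q a l"] E_minus_commute[of "q (cprev n a) k" "q (cprev n a) i"]
  by (auto simp: exchange_coeff_def r_diag_def dlog_site_def dlog_prev_def dlog_phi_def)

lemma phi_exchange:
  assumes site: "a \<in> {1..n}" and regular: "regular a z" "regular a w" and diff_zw: "theta (z - w) \<noteq> 0"
  shows "phi z (u a i l) * phi w (u a k j) * r_swap (z - w) (q a) l j
      - r_swap (z - w) (q (cprev n a)) i k * (phi z (u a k j) * phi w (u a i l))
    = phi z (u a i j) * phi w (u a k l) * exchange_coeff a z w i j k l"
proof -
  let ?x = "q (cprev n a)" and ?y = "q a"
  have shift: "theta (u a i j) \<noteq> 0" "theta (z + u a i j) \<noteq> 0" "theta (w + u a i j) \<noteq> 0" for i j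
    using theta_shift_nonzero[OF site] regular by (auto simp: regular_def)
  have diff: "i \<noteq> k \<Longrightarrow> theta (?x i - ?x k) \<noteq> 0" "i \<noteq> k \<Longrightarrow> theta (?y i - ?y k) \<noteq> 0" for i k
    using theta_diff_nonzero site cprev_mem[OF site] by simp_all
  consider (equal) "i = k" "j = l" | (rows_differ) "i \<noteq> k" "j = l"
    | (columns_differ) "i = k" "j \<noteq> l" | (both_differ) "i \<noteq> k" "j \<noteq> l"
    by blast
  then show ?thesis
  proof cases
    case equal
    then show ?thesis
      by (simp add: exchange_coeff_eq r_swap_def)
  next
    case rows_differ
    have "u a i j - u a k j = ?x i - ?x k"
      by simp
    with phi_mult_E_diff[OF diff_zw, of "u a i j" "u a k j"] diff(1)[OF \<open>i \<noteq> k\<close>] shift rows_differ show ?thesis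
      by (simp add: exchange_coeff_eq r_swap_def algebra_simps)
  next
    case columns_differ
    have "u a i j - u a i l = ?y l - ?y j"
      by simp
    with phi_mult_E_diff[OF diff_zw, of "u a i j" "u a i l"] diff(2)[of l j] shift columns_differ show ?thesis
      by (simp add: exchange_coeff_eq r_swap_def)
  next
    case both_differ
    have sums: "(?y l - ?y j) + u a i l = u a i j" "(?x k - ?x i) + u a i l = u a k l"
        "(?y l - ?y j) + (?x k - ?x i) + u a i l = u a k j"
      by simp_all
    show ?thesis
      using phi_mult_E_add[OF diff_zw, of "?y l - ?y j" "?x k - ?x i" "u a i l", unfolded sums]
        phi_minus_commute[of w z "?x k" "?x i"] diff(1)[of k i] diff(2)[of l j] shift both_differ
      by (simp add: exchange_coeff_eq r_swap_def)
  qed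
qed

definition column_factor :: "nat \<Rightarrow> 'N \<Rightarrow> complex" where
  "column_factor a j = (\<Prod>l\<in>UNIV. theta (q a j - q (cprev n a) l - eta))
    / (theta (- eta) * (\<Prod>l\<in>UNIV - {j}. theta (q a j - q a l))) * exp (p a j / c)"

lemma Lmat_nth: "L a z $ i $ j = phi z (u a i j) * column_factor a j"
  by (simp add: Lmat_def column_factor_def)

lemma Lmat_exchange:
  assumes "a \<in> {1..n}" "regular a z" "regular a w" "theta (z - w) \<noteq> 0"
  shows "L a z $ i $ l * L a w $ k $ j * r_swap (z - w) (q a) l j
      - r_swap (z - w) (q (cprev n a)) i k * (L a z $ k $ j * L a w $ i $ l)
    = L a z $ i $ j * L a w $ k $ l * exchange_coeff a z w i j k l"
  using arg_cong[OF phi_exchange[OF assms, of i l k j], of "\<lambda>t. t * (column_factor a j * column_factor a l)"]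
  unfolding Lmat_nth by (simp add: algebra_simps)

lemma site_bracket_nth:
  assumes site: "a \<in> {1..n}" and regular: "regular a z" "regular a w" and diff_zw: "theta (z - w) \<noteq> 0"
    and inv: "invertible (L a z)" "invertible (L a w)"
  shows "(L\<^sub>1 a z ** L\<^sub>2 a w ** rmat tau a q z w
        - rmat tau (cprev n a) q z w ** L\<^sub>1 a z ** L\<^sub>2 a w
        + L\<^sub>1 a z ** s_plus a z ** L\<^sub>2 a w
        - L\<^sub>2 a w ** s_minus a w ** L\<^sub>1 a z) $ (i, k) $ (j, l)
    = L a z $ i $ j * L a w $ k $ l * (dlog_site a w j k l - dlog_site a z l i j)"
proof -
  have "rmat tau (cprev n a) q z w ** L\<^sub>1 a z ** L\<^sub>2 a w
      = rmat tau (cprev n a) q z w ** tens (L a z) (L a w)"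
    by (simp only: L1_mult_L2 matrix_mul_assoc[symmetric])
  then show ?thesis
    unfolding vector_add_component vector_minus_component L1_splus_L2_nth[OF inv(1)] L2_sminus_L1_nth[OF inv(2)]
    using Lmat_exchange[OF site regular diff_zw, of i l k j]
    by (simp only: L1_mult_L2 tens_mult_rmat_nth rmat_mult_tens_nth) (simp add: exchange_coeff_def algebra_simps)
qed

end

theorem theorem1:
  fixes tau eta c z w :: complex and n a b :: nat and p q :: "nat \<Rightarrow> 'N::finite \<Rightarrow> complex"
  assumes "Im tau > 0" and "c \<noteq> 0" and "n \<ge> 1" and "a \<in> {1..n}" and "b \<in> {1..n}"
    and "jtheta tau (- eta) \<noteq> 0"
    and "jtheta tau z \<noteq> 0" and "jtheta tau w \<noteq> 0" and "jtheta tau (z - w) \<noteq> 0"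
    and "\<forall>d\<in>{1..n}. \<forall>i j. jtheta tau (q (cprev n d) i - q d j + eta) \<noteq> 0"
    and "\<forall>d\<in>{1..n}. \<forall>i j. i \<noteq> j \<longrightarrow> jtheta tau (q d i - q d j) \<noteq> 0"
    and "\<forall>d\<in>{1..n}. \<forall>i j. jtheta tau (z + q (cprev n d) i - q d j + eta) \<noteq> 0
                          \<and> jtheta tau (w + q (cprev n d) i - q d j + eta) \<noteq> 0"
    and "\<forall>d\<in>{1..n}. invertible (Lmat tau eta c n d z p q) \<and> invertible (Lmat tau eta c n d w p q)"
  shows "smat c (pbm n (\<lambda>p q. Lmat tau eta c n a z p q) (\<lambda>p q. Lmat tau eta c n b w p q) p q) =
      (if a = b then
          L1 tau eta c n b z p q ** L2 tau eta c n b w p q ** rmat tau b q z w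
        - rmat tau (cprev n b) q z w ** L1 tau eta c n b z p q ** L2 tau eta c n b w p q
        + L1 tau eta c n b z p q ** splus tau eta c n b z p q ** L2 tau eta c n b w p q
        - L2 tau eta c n b w p q ** sminus tau eta c n b w p q ** L1 tau eta c n b z p q
       else 0)
    + (if a = cprev n b then
          L1 tau eta c n (cprev n b) z p q ** L2 tau eta c n b w p q ** sminus tau eta c n b w p q
       else 0)
    - (if a = cnext n b then
          L1 tau eta c n (cnext n b) z p q ** L2 tau eta c n b w p q ** splus tau eta c n (cnext n b) z p q
       else 0)"
    (is "?lhs = ?rhs")
proof (rule tensor_eqI)
  fix i k j l
  interpret elliptic_chain tau eta c n p q
    using assms by unfold_locales auto
  have regular: "regular d z" "regular d w" and inv: "invertible (L d z)" "invertible (L d w)" if "d \<in> {1..n}" for d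
    using assms that by (simp_all add: regular_def add_diff_eq add.assoc[symmetric])
  have if_nth: "(if P then M else 0) $ x $ y = of_bool P * M $ x $ y"
    for P and M :: "complex^('N \<times> 'N)^('N \<times> 'N)" and x y
    by simp
  have "?lhs $ (i, k) $ (j, l) = L a z $ i $ j * L b w $ k $ l
      * (of_bool (a = b) * (dlog_site b w j k l - dlog_site b z l i j)
        + of_bool (a = cprev n b) * dlog_prev b w j k l - of_bool (a = cnext n b) * dlog_prev a z l i j)"
    using pb_Lmat assms(4,5) regular by (simp add: pbm_def)
  also have "\<dots> = ?rhs $ (i, k) $ (j, l)"
    using site_bracket_nth[of b z w i k j l] L1_L2_sminus_nth[of b w a z i k j l]
      L1_L2_splus_nth[of a z b w i k j l] assms(4,5,9) regular inv
    unfolding vector_add_component vector_minus_component if_nth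
    by (auto simp: algebra_simps)
  finally show "?lhs $ (i, k) $ (j, l) = ?rhs $ (i, k) $ (j, l)" .
qed

end
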